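(* Let $n\ge2$, let $0\le\alpha\in C_0^\infty(\mathbf{R}^n)$ with $\operatorname{supp}\alpha\subset B(0,R)$, let $0\le\chi\in C_0^\infty(\mathbf{R})$, $\chi\not\equiv0$, with $\operatorname{supp}\chi\subset(-\delta,\delta)$, and let $T>R+\delta$. For $\omega\in S^{n-1}$, let $\delta u$ be the linearized solution (defined in the context) and for $z\in\omega^\perp$ let $\mathrm{Data}(z,\omega)\ge0$ be given by $$\mathrm{Data}^2(z,\omega)=h\int_{|s-T|\le\delta}\big|\delta u(T,z+s\omega)\big|^2\,\mathrm{d}s .$$ Then, as $h\to0$, $$\mathrm{Data}(z,\omega)=C\,|X\alpha(z,\omega)|+O(h^\infty),\qquad C=\frac{\sqrt{41}}{24}\Big(\int_{\mathbf{R}}\chi^6(\sigma)\,\mathrm{d}\sigma\Big)^{1/2},$$ so that $X\alpha(\cdot,\omega)$ in the direction $\omega$ is recovered from the limit of $\mathrm{Data}(\cdot,\omega)$ as $h\to0$ by $X\alpha(z,\omega)=C^{-1}\lim_{h\to0}\mathrm{Data}(z,\omega)$. Moreover, the limits $\lim_{h\to0}\mathrm{Data}(z,\omega)$ for all $\omega\in S^{n-1}$ and $z\in\omega^\perp$ determine $\alpha$ uniquely.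
   Context: $B(0,R)=\{|x|<R\}$, $\omega^\perp=\{z\in\mathbf{R}^n: z\cdot\omega=0\}$, and $X\alpha(z,\omega)=\int_{\mathbf{R}}\alpha(z+s\omega)\,\mathrm{d}s$ is the X-ray transform. The underlying problem is $u_{tt}-\Delta u+\alpha(x)u^3=0$ with real incoming wave $u_{\mathrm{in}}=h^{-1/2}\chi(-t+x\cdot\omega)\cos\frac{-t+x\cdot\omega}{h}$. The linearized solution is the linearization near $\alpha=0$ of the leading term $h^{-1/2}\sum_k e^{\mathrm{i}k(-t+x\cdot\omega)/h}a_0^{(k)}$ of its weakly non-linear asymptotic expansion. Explicitly, put $A=\chi(-t+x\cdot\omega)$, $\mathcal{R}(x,\omega)=\int_{-\infty}^0\alpha(x+s\omega)\,\mathrm{d}s$, and $$h^{1/2}u_1=A\cos\frac{-t+x\cdot\omega}{h}+\frac{3A^3}{8}\,\mathcal{R}\,\sin\frac{-t+x\cdot\omega}{h}+\frac{A^3}{24}\,\mathcal{R}\,\sin\frac{3(-t+x\cdot\omega)}{h}.$$ With $u_L=h^{-1/2}A\cos\frac{-t+x\cdot\omega}{h}$ (the solution for $\alpha=0$), the linearized solution is $\delta u=u_1-u_L$, i.e. $$\delta u(t,x)=h^{-1/2}\Big(\frac{3A^3}{8}\,\mathcal{R}\,\sin\frac{-t+x\cdot\omega}{h}+\frac{A^3}{24}\,\mathcal{R}\,\sin\frac{3(-t+x\cdot\omega)}{h}\Big).$$ $O(h^\infty)$ means $O(h^N)$ for every $N$. *)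

theory Defs
  imports "HOL-Analysis.Analysis" "HOL-Library.Landau_Symbols"
begin

text \<open>The libraries have no notion of \<open>C\<^sup>k\<close> functions of several variables. A function is of class
  \<open>C\<^bsup>k+1\<^esup>\<close> iff it is differentiable and all its directional derivatives are of class \<open>C\<^sup>k\<close>
  (this is equivalent to the usual definition on finite-dimensional spaces).\<close>

fun Ck :: "nat \<Rightarrow> ('a::euclidean_space \<Rightarrow> real) \<Rightarrow> bool" where
  "Ck 0 f \<longleftrightarrow> continuous_on UNIV f"
| "Ck (Suc k) f \<longleftrightarrow> (\<forall>x. f differentiable (at x)) \<and> (\<forall>v. Ck k (\<lambda>x. frechet_derivative f (at x) v))"

definition supp :: "('a::euclidean_space \<Rightarrow> real) \<Rightarrow> 'a set" where
  "supp f = closure {x. f x \<noteq> 0}"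

definition C0_infinity :: "('a::euclidean_space \<Rightarrow> real) \<Rightarrow> bool" where
  "C0_infinity f \<longleftrightarrow> (\<forall>k. Ck k f) \<and> compact (supp f)"

definition xray :: "(real ^ 'n \<Rightarrow> real) \<Rightarrow> real ^ 'n \<Rightarrow> real ^ 'n \<Rightarrow> real" where
  "xray \<alpha> z \<omega> = (LBINT s. \<alpha> (z + s *\<^sub>R \<omega>))"

definition half_line_integral :: "(real ^ 'n \<Rightarrow> real) \<Rightarrow> real ^ 'n \<Rightarrow> real ^ 'n \<Rightarrow> real" where
  "half_line_integral \<alpha> x \<omega> = (LBINT s:{..0}. \<alpha> (x + s *\<^sub>R \<omega>))"

text \<open>\<open>u_L\<close> is the solution for \<open>\<alpha> = 0\<close>, and \<open>u_1\<close> the linearization in \<open>\<alpha>\<close> near \<open>\<alpha> = 0\<close> of the leading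
  term of the weakly nonlinear expansion of the solution of \<open>u\<^sub>t\<^sub>t - \<Delta>u + \<alpha> u\<^sup>3 = 0\<close> whose incoming
  wave is \<open>u_L\<close>.\<close>

definition u_L :: "(real \<Rightarrow> real) \<Rightarrow> real ^ 'n \<Rightarrow> real \<Rightarrow> real \<Rightarrow> real ^ 'n \<Rightarrow> real" where
  "u_L chi \<omega> h t x = h powr (-1/2) * (chi (-t + x \<bullet> \<omega>) * cos ((-t + x \<bullet> \<omega>) / h))"

definition u_1 ::
  "(real ^ 'n \<Rightarrow> real) \<Rightarrow> (real \<Rightarrow> real) \<Rightarrow> real ^ 'n \<Rightarrow> real \<Rightarrow> real \<Rightarrow> real ^ 'n \<Rightarrow> real" where
  "u_1 \<alpha> chi \<omega> h t x =
     (let \<phi> = -t + x \<bullet> \<omega>; A = chi \<phi>; I = half_line_integral \<alpha> x \<omega>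
      in h powr (-1/2) *
           (A * cos (\<phi> / h) + 3 * A ^ 3 / 8 * I * sin (\<phi> / h) + A ^ 3 / 24 * I * sin (3 * \<phi> / h)))"

definition delta_u ::
  "(real ^ 'n \<Rightarrow> real) \<Rightarrow> (real \<Rightarrow> real) \<Rightarrow> real ^ 'n \<Rightarrow> real \<Rightarrow> real \<Rightarrow> real ^ 'n \<Rightarrow> real" where
  "delta_u \<alpha> chi \<omega> h t x = u_1 \<alpha> chi \<omega> h t x - u_L chi \<omega> h t x"

definition Data ::
  "(real ^ 'n \<Rightarrow> real) \<Rightarrow> (real \<Rightarrow> real) \<Rightarrow> real \<Rightarrow> real \<Rightarrow> real \<Rightarrow> real ^ 'n \<Rightarrow> real ^ 'n \<Rightarrow> real" where
  "Data \<alpha> chi \<delta> T h z \<omega> =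
     sqrt (h * (LBINT s:{s. \<bar>s - T\<bar> \<le> \<delta>}. \<bar>delta_u \<alpha> chi \<omega> h T (z + s *\<^sub>R \<omega>)\<bar>\<^sup>2))"

definition C_const :: "(real \<Rightarrow> real) \<Rightarrow> real" where
  "C_const chi = sqrt 41 / 24 * sqrt (LBINT \<sigma>. chi \<sigma> ^ 6)"

definition rays :: "((real ^ 'n) \<times> (real ^ 'n)) set" where
  "rays = {(z, \<omega>). norm \<omega> = 1 \<and> z \<bullet> \<omega> = 0}"

text \<open>\<open>f h p = O(h\<^sup>\<infinity>)\<close> as \<open>h \<rightarrow> 0+\<close>, uniformly in the parameter \<open>p \<in> P\<close>: for every \<open>N\<close> there are \<open>c\<close> and
  \<open>h\<^sub>0 > 0\<close> such that \<open>\<bar>f h p\<bar> \<le> c h\<^sup>N\<close> for all \<open>0 < h < h\<^sub>0\<close> and all \<open>p \<in> P\<close>.\<close>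

definition O_h_infinity_on :: "'p set \<Rightarrow> (real \<Rightarrow> 'p \<Rightarrow> real) \<Rightarrow> bool" where
  "O_h_infinity_on P f \<longleftrightarrow>
     (\<forall>N::nat. (\<lambda>(h, p). f h p) \<in> O[at_right 0 \<times>\<^sub>F principal P](\<lambda>(h, p). h ^ N))"

end

theory Submission
  imports Defs
begin

text \<open>Behind the potential, the perturbation of the wave is
  \<open>h\<^sup>-\<^sup>1\<^sup>/\<^sup>2 \<chi>\<^sup>3(\<sigma>) X\<alpha> (3/8 sin (\<sigma>/h) + 1/24 sin (3\<sigma>/h))\<close> with \<open>\<sigma> = s - T\<close>: at time \<open>T > R + \<delta>\<close> the whole
  window of measurement lies beyond the support of \<open>\<alpha>\<close>, so the backward half-line integral is the
  X-ray transform (\<open>half_line_integral_eq_xray\<close>). Hence \<open>Data\<close> is exactly \<open>\<bar>X\<alpha>\<bar>\<close> times a number that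
  depends on \<open>\<chi>\<close> and \<open>h\<close> only (\<open>Data_eq\<close>). The square of that number is the integral of \<open>\<chi>\<^sup>6\<close> against
  the square of the two harmonics, whose mean is \<open>41/576\<close> (\<open>harmonics_square\<close>); the rest
  oscillates at frequencies of order \<open>1/h\<close> against a smooth amplitude of compact support and is
  \<open>O(h\<^sup>\<infinity>)\<close> by repeated integration by parts (\<open>non_stationary_phase\<close>). As \<open>X\<alpha>\<close> is bounded, the
  remainder is uniform over all rays.

  Uniqueness is the injectivity of the X-ray transform on functions of compact support
  (\<open>xray_injective\<close>). If all line integrals of \<open>f\<close> vanish then so do those of \<open>f x * exp (\<xi> \<bullet> x)\<close> along any
  direction orthogonal to \<open>\<xi>\<close>, because the exponential is constant on such lines; integrating over all
  these parallel lines, the Laplace transform of \<open>f\<close> vanishes identically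
  (\<open>integral_eq_0_if_line_integrals_eq_0\<close>). Real exponentials span an algebra that is uniformly
  dense on compact sets, so \<open>f\<close> is orthogonal to itself (\<open>eq_0_if_Laplace_transform_eq_0\<close>).\<close>

section \<open>Continuous functions of compact support\<close>

lemma integrable_continuous_compact_support:
  fixes f :: "'a::euclidean_space \<Rightarrow> real"
  assumes "continuous_on UNIV f" "compact K" "\<And>x. x \<notin> K \<Longrightarrow> f x = 0"
  shows "integrable lborel f"
proof -
  have "integrable lborel (\<lambda>x. indicator K x *\<^sub>R f x)"
    using assms by (intro borel_integrable_compact) (auto intro: continuous_on_subset)
  moreover have "(\<lambda>x. indicator K x *\<^sub>R f x) = f"
    using assms(3) by (auto simp: fun_eq_iff indicator_def)
  ultimately show ?thesis by simp
qed

lemma continuous_compact_support_bounded: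
  fixes f :: "'a::euclidean_space \<Rightarrow> real"
  assumes "continuous_on UNIV f" "compact K" "\<And>x. x \<notin> K \<Longrightarrow> f x = 0"
  obtains M where "M \<ge> 0" "\<And>x. \<bar>f x\<bar> \<le> M"
proof -
  have "compact (f ` K)"
    by (intro compact_continuous_image continuous_on_subset[OF assms(1)] assms(2)) simp
  then have "\<exists>M. \<forall>x\<in>K. \<bar>f x\<bar> \<le> M"
    by (auto dest!: compact_imp_bounded simp: bounded_iff)
  then obtain M where M: "\<forall>x\<in>K. \<bar>f x\<bar> \<le> M" ..
  show ?thesis
  proof (rule that[of "max M 0"])
    show "\<bar>f x\<bar> \<le> max M 0" for x
      using M assms(3)[of x] by (cases "x \<in> K") auto
  qed simp
qed

text \<open>The set where \<open>f\<close> does not vanish is open, and a nonempty open set is not negligible.\<close>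

lemma continuous_integral_nonneg_eq_0_imp_eq_0:
  fixes f :: "'a::euclidean_space \<Rightarrow> real"
  assumes cont: "continuous_on UNIV f" and int: "integrable lborel f"
    and nonneg: "\<And>x. 0 \<le> f x" and zero: "(LBINT x. f x) = 0"
  shows "f x = 0"
proof -
  have "AE x in lborel. f x = 0"
    using integral_nonneg_eq_0_iff_AE[OF int] nonneg zero by simp
  then have "{x. f x \<noteq> 0} \<in> null_sets lborel"
    using borel_measurable_integrable[OF int] by (subst (asm) AE_iff_null) auto
  then have "negligible {x. f x \<noteq> 0}"
    by (simp add: negligible_iff_null_sets null_sets_completionI)
  moreover have "open {x. f x \<noteq> 0}"
    by (intro open_Collect_neq cont continuous_on_const)
  ultimately have "{x. f x \<noteq> 0} = {}"
    using open_not_negligible by metis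
  then show ?thesis by simp
qed

lemma support_in_supp: "f x \<noteq> 0 \<Longrightarrow> x \<in> supp f"
  unfolding supp_def using closure_subset[of "{x. f x \<noteq> 0}"] by auto

lemma eq_0_outside_supp: "x \<notin> supp f \<Longrightarrow> f x = 0"
  by (rule ccontr) (erule notE, rule support_in_supp)

lemma C0_infinityD:
  assumes "C0_infinity f"
  shows "continuous_on UNIV f" "compact (supp f)" "Ck k f"
proof -
  have Ck: "Ck k f" for k
    using assms by (simp add: C0_infinity_def)
  then show "Ck k f" .
  show "continuous_on UNIV f"
    using Ck[of 0] by simp
  show "compact (supp f)"
    using assms by (simp add: C0_infinity_def)
qed

section \<open>The algebra of \<open>C\<^sup>k\<close> functions\<close>

text \<open>These closure properties serve to show that \<open>\<chi>\<^sup>6\<close>, the amplitude of the oscillatory integrals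
  below, is smooth.\<close>

lemma Ck_Suc_imp_Ck: "Ck (Suc k) f \<Longrightarrow> Ck k f"
proof (induction k arbitrary: f)
  case 0
  then show ?case
    by (auto intro!: differentiable_imp_continuous_on simp: differentiable_on_def)
next
  case (Suc k)
  then show ?case by (metis Ck.simps(2))
qed

lemma Ck_imp_continuous: "Ck k f \<Longrightarrow> continuous_on UNIV f"
proof (induction k)
  case (Suc k)
  then show ?case using Ck_Suc_imp_Ck by blast
qed simp

lemma Ck_const: "Ck k (\<lambda>x. c)"
  by (induction k arbitrary: c) auto

lemma Ck_add: "Ck k f \<Longrightarrow> Ck k g \<Longrightarrow> Ck k (\<lambda>x. f x + g x)"
proof (induction k arbitrary: f g)
  case 0
  then show ?case by (auto intro: continuous_intros)
next
  case (Suc k)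
  have "frechet_derivative (\<lambda>x. f x + g x) (at x) =
      (\<lambda>v. frechet_derivative f (at x) v + frechet_derivative g (at x) v)" for x
    using Suc.prems by (intro frechet_derivative_at[symmetric])
      (auto intro!: derivative_eq_intros simp: frechet_derivative_works)
  with Suc show ?case by auto
qed

lemma Ck_mult: "Ck k f \<Longrightarrow> Ck k g \<Longrightarrow> Ck k (\<lambda>x. f x * g x)"
proof (induction k arbitrary: f g)
  case 0
  then show ?case by (auto intro: continuous_intros)
next
  case (Suc k)
  have "frechet_derivative (\<lambda>x. f x * g x) (at x) =
      (\<lambda>v. f x * frechet_derivative g (at x) v + frechet_derivative f (at x) v * g x)" for x
    using Suc.prems by (intro frechet_derivative_at[symmetric])
      (auto intro!: derivative_eq_intros simp: frechet_derivative_works)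
  moreover have "Ck k f" "Ck k g"
    using Suc.prems Ck_Suc_imp_Ck by auto
  ultimately show ?case
    using Suc by (auto intro!: Ck_add)
qed

lemma Ck_power: "Ck k f \<Longrightarrow> Ck k (\<lambda>x. f x ^ m)"
  by (induction m) (auto intro: Ck_const Ck_mult)

section \<open>Non-stationary phase\<close>

lemma integral_derivative_compact_support:
  fixes F f :: "real \<Rightarrow> real"
  assumes der: "\<And>x. (F has_real_derivative f x) (at x)" and cont: "continuous_on UNIV f"
    and F0: "\<And>x. x \<notin> {a<..<b} \<Longrightarrow> F x = 0" and f0: "\<And>x. x \<notin> {a<..<b} \<Longrightarrow> f x = 0"
  shows "(LBINT x. f x) = 0"
proof (cases "a \<le> b")
  case True
  have "(LBINT x. indicator {a..b} x *\<^sub>R f x) = F b - F a"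
    using True der by (intro integral_FTC_atLeastAtMost continuous_on_subset[OF cont])
      (auto simp: has_real_derivative_iff_has_vector_derivative has_vector_derivative_at_within)
  moreover have "(\<lambda>x. indicator {a..b} x *\<^sub>R f x) = f"
  proof
    show "indicator {a..b} x *\<^sub>R f x = f x" for x
      using f0[of x] by (cases "x \<in> {a<..<b}") auto
  qed
  ultimately show ?thesis using F0 by simp
next
  case False
  then have "f = (\<lambda>_. 0)" using f0 by auto
  then show ?thesis by simp
qed

lemma frechet_derivative_eq_0_outside_supp:
  assumes "x \<notin> supp f"
  shows "frechet_derivative f (at x) v = 0"
proof -
  have "(f has_derivative (\<lambda>_. 0)) (at x)"
  proof (rule has_derivative_transform_within_open[where f = "\<lambda>_. 0" and s = "- supp f"])
    show "open (- supp f)" by (simp add: supp_def open_Compl)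
  qed (use assms support_in_supp[of f] in fastforce)+
  from frechet_derivative_at[OF this] show ?thesis by metis
qed

lemma supp_frechet_derivative: "supp (\<lambda>x. frechet_derivative f (at x) v) \<subseteq> supp f"
proof -
  have "{x. frechet_derivative f (at x) v \<noteq> 0} \<subseteq> supp f"
    using frechet_derivative_eq_0_outside_supp by blast
  then show ?thesis
    unfolding supp_def[of "\<lambda>x. frechet_derivative f (at x) v"]
    by (rule closure_minimal) (simp add: supp_def)
qed

text \<open>Since the phase \<open>\<mu> x + p\<close> has no critical point and \<open>f\<close> has no boundary terms, each integration
  by parts exchanges one derivative of \<open>f\<close> for one factor \<open>1 / \<mu>\<close>. It turns the cosine into a sine;
  the shift \<open>p\<close> is a parameter because a sine is the cosine with phase \<open>p - pi / 2\<close>, which keeps the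
  induction on the number of derivatives within one family of integrals.\<close>

lemma non_stationary_phase:
  fixes f :: "real \<Rightarrow> real"
  assumes "Ck N f" "supp f \<subseteq> {a<..<b}"
  shows "\<exists>c\<ge>0. \<forall>\<mu>>0. \<forall>p. \<bar>LBINT x. f x * cos (\<mu> * x + p)\<bar> \<le> c / \<mu> ^ N"
  using assms
proof (induction N arbitrary: f)
  case 0
  have f0: "f x = 0" if "x \<notin> {a<..<b}" for x
    using that 0(2) support_in_supp by blast
  have cont: "continuous_on UNIV f" using 0 by simp
  have int: "integrable lborel (\<lambda>x. \<bar>f x\<bar>)" 
    by (rule integrable_continuous_compact_support[of _ "{a..b}"])
      (use f0 in \<open>auto intro!: continuous_intros cont\<close>)
  have int': "integrable lborel (\<lambda>x. f x * cos (\<mu> * x + p))" for \<mu> p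
    by (rule integrable_continuous_compact_support[of _ "{a..b}"])
      (use f0 in \<open>auto intro!: continuous_intros cont\<close>)
  have "\<bar>LBINT x. f x * cos (\<mu> * x + p)\<bar> \<le> (LBINT x. \<bar>f x\<bar>)" for \<mu> p
  proof -
    have "\<bar>LBINT x. f x * cos (\<mu> * x + p)\<bar> \<le> (LBINT x. \<bar>f x * cos (\<mu> * x + p)\<bar>)"
      by (rule integral_abs_bound)
    also have "\<dots> \<le> (LBINT x. \<bar>f x\<bar>)"
      by (intro integral_mono int integrable_abs int') (simp add: abs_mult mult_left_le)
    finally show ?thesis .
  qed
  then show ?case by (intro exI[of _ "LBINT x. \<bar>f x\<bar>"]) auto
next
  case (Suc N)
  define f' where "f' x = frechet_derivative f (at x) 1" for x
  have f0: "f x = 0" if "x \<notin> {a<..<b}" for x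
    using that Suc.prems(2) support_in_supp by blast
  have f'0: "f' x = 0" if "x \<notin> {a<..<b}" for x
    unfolding f'_def using that Suc.prems(2) frechet_derivative_eq_0_outside_supp by blast
  have "Ck N f'" "supp f' \<subseteq> {a<..<b}"
    using Suc.prems supp_frechet_derivative[of f 1] unfolding f'_def by auto
  with Suc.IH obtain c where c: "c \<ge> 0"
    "\<And>\<mu> p. \<mu> > 0 \<Longrightarrow> \<bar>LBINT x. f' x * cos (\<mu> * x + p)\<bar> \<le> c / \<mu> ^ N"
    by metis
  have cont: "continuous_on UNIV f" "continuous_on UNIV f'"
    using Ck_imp_continuous[OF Suc.prems(1)] Ck_imp_continuous[OF \<open>Ck N f'\<close>] by blast+
  have der: "(f has_real_derivative f' x) (at x)" for x
  proof -
    have d: "(f has_derivative frechet_derivative f (at x)) (at x)"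
      using Suc.prems(1) frechet_derivative_works[of f "at x"] by simp
    then interpret bounded_linear "frechet_derivative f (at x)"
      by (rule has_derivative_bounded_linear)
    have "frechet_derivative f (at x) = (*) (f' x)"
    proof
      show "frechet_derivative f (at x) v = f' x * v" for v
        using scale[of v 1] by (simp add: f'_def)
    qed
    with d show ?thesis by (simp add: has_field_derivative_def)
  qed
  have "\<bar>LBINT x. f x * cos (\<mu> * x + p)\<bar> \<le> c / \<mu> ^ Suc N" if "\<mu> > 0" for \<mu> p
  proof -
    have phase: "sin t = cos (t - pi / 2)" for t :: real
      by (simp add: cos_diff)
    have int1: "integrable lborel (\<lambda>x. f' x * sin (\<mu> * x + p))"
      by (rule integrable_continuous_compact_support[of _ "{a..b}"])
        (use f'0 in \<open>auto intro!: continuous_intros cont\<close>)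
    have int2: "integrable lborel (\<lambda>x. f x * cos (\<mu> * x + p))"
      by (rule integrable_continuous_compact_support[of _ "{a..b}"])
        (use f0 in \<open>auto intro!: continuous_intros cont\<close>)
    \<comment> \<open>the integrand is the derivative of \<open>f x * sin (\<mu> * x + p)\<close>\<close>
    have "(LBINT x. f' x * sin (\<mu> * x + p) + \<mu> * (f x * cos (\<mu> * x + p))) = 0"
      by (rule integral_derivative_compact_support[of "\<lambda>x. f x * sin (\<mu> * x + p)" _ a b])
        (use f0 f'0 in \<open>auto intro!: continuous_intros cont derivative_eq_intros der\<close>)
    then have "(LBINT x. f' x * sin (\<mu> * x + p)) + \<mu> * (LBINT x. f x * cos (\<mu> * x + p)) = 0"
      using int1 int2 by simp
    then have "\<mu> * (LBINT x. f x * cos (\<mu> * x + p)) = - (LBINT x. f' x * sin (\<mu> * x + p))"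
      by simp
    also have "\<dots> = - (LBINT x. f' x * cos (\<mu> * x + (p - pi / 2)))"
      by (subst phase) (simp add: algebra_simps)
    finally have "\<bar>\<mu> * (LBINT x. f x * cos (\<mu> * x + p))\<bar> \<le> c / \<mu> ^ N"
      using c(2)[OF that, of "p - pi / 2"] by simp
    then have "\<mu> * \<bar>LBINT x. f x * cos (\<mu> * x + p)\<bar> \<le> c / \<mu> ^ N"
      using that by (simp add: abs_mult)
    then show ?thesis
      using that by (simp add: field_simps)
  qed
  with c(1) show ?case by (intro exI[of _ c]) simp
qed

section \<open>The X-ray transform\<close>

lemma raysD: "(z, \<omega>) \<in> rays \<Longrightarrow> norm \<omega> = 1" "(z, \<omega>) \<in> rays \<Longrightarrow> z \<bullet> \<omega> = 0"
  by (auto simp: rays_def)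

text \<open>On the line of a ray \<open>(z, \<omega>)\<close> the parameter \<open>s\<close> is the component of the point along \<open>\<omega>\<close>.\<close>

lemma abs_parameter_le_norm:
  assumes "(z, \<omega>) \<in> rays"
  shows "\<bar>s\<bar> \<le> norm (z + s *\<^sub>R \<omega>)"
proof -
  have "(z + s *\<^sub>R \<omega>) \<bullet> \<omega> = s"
    using raysD[OF assms] by (simp add: inner_add_left dot_square_norm)
  then show ?thesis
    using Cauchy_Schwarz_ineq2[of "z + s *\<^sub>R \<omega>" \<omega>] raysD[OF assms] by simp
qed

lemma zero_on_line_outside:
  assumes "supp f \<subseteq> ball 0 R" "(z, \<omega>) \<in> rays" "\<bar>s\<bar> \<ge> R"
  shows "f (z + s *\<^sub>R \<omega>) = 0"
proof -
  have "z + s *\<^sub>R \<omega> \<notin> supp f"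
    using assms(1,3) abs_parameter_le_norm[OF assms(2), of s] by auto
  then show ?thesis by (rule eq_0_outside_supp)
qed

lemma xray_shift:
  "xray f (z + t *\<^sub>R \<omega>) \<omega> = xray f z \<omega>"
proof -
  have "(LBINT s. f (z + s *\<^sub>R \<omega>)) = (LBINT s. f (z + (t + s) *\<^sub>R \<omega>))"
    using lborel_integral_real_affine[of 1 "\<lambda>s. f (z + s *\<^sub>R \<omega>)" t] by simp
  then show ?thesis
    by (simp add: xray_def algebra_simps)
qed

text \<open>Beyond the support of \<open>f\<close>, the backward half-line already contains everything that the whole line
  sees. This is how the probing wave, measured after it has crossed the potential, carries the X-ray
  transform.\<close>

lemma half_line_integral_eq_xray:
  assumes "supp f \<subseteq> ball 0 R" "(z, \<omega>) \<in> rays" "s \<ge> R"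
  shows "half_line_integral f (z + s *\<^sub>R \<omega>) \<omega> = xray f z \<omega>"
proof -
  have "indicator {..0::real} r *\<^sub>R f (z + s *\<^sub>R \<omega> + r *\<^sub>R \<omega>) = f (z + s *\<^sub>R \<omega> + r *\<^sub>R \<omega>)" for r
    using zero_on_line_outside[OF assms(1,2), of "s + r"] assms(3)
    by (cases "r \<le> 0") (auto simp: algebra_simps)
  then have "half_line_integral f (z + s *\<^sub>R \<omega>) \<omega> = xray f (z + s *\<^sub>R \<omega>) \<omega>"
    by (simp only: half_line_integral_def xray_def set_lebesgue_integral_def)
  then show ?thesis by (simp add: xray_shift)
qed

lemma integrable_on_line:
  assumes "C0_infinity f" "supp f \<subseteq> ball 0 R" "(z, \<omega>) \<in> rays"
  shows "integrable lborel (\<lambda>s. f (z + s *\<^sub>R \<omega>))"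
proof (rule integrable_continuous_compact_support[of _ "{-\<bar>R\<bar>..\<bar>R\<bar>}"])
  show "continuous_on UNIV (\<lambda>s. f (z + s *\<^sub>R \<omega>))"
    by (intro continuous_on_compose2[OF C0_infinityD(1)[OF assms(1)]] continuous_intros) auto
  show "f (z + s *\<^sub>R \<omega>) = 0" if "s \<notin> {-\<bar>R\<bar>..\<bar>R\<bar>}" for s
    using that by (intro zero_on_line_outside[OF assms(2,3)]) auto
qed simp

text \<open>Every ray meets \<open>ball 0 R\<close> in a segment of length at most \<open>2 R\<close>. The bound is what makes the
  error term of the data uniform over all rays.\<close>

lemma xray_bounded:
  fixes f :: "real ^ 'n \<Rightarrow> real"
  assumes "C0_infinity f" "supp f \<subseteq> ball 0 R"
  obtains B where "\<And>z \<omega>. (z, \<omega>) \<in> rays \<Longrightarrow> \<bar>xray f z \<omega>\<bar> \<le> B"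
proof -
  obtain M where M: "M \<ge> 0" "\<And>x. \<bar>f x\<bar> \<le> M"
    using continuous_compact_support_bounded[OF C0_infinityD(1,2)[OF assms(1)] eq_0_outside_supp[of _ f]] by blast
  show ?thesis
  proof (rule that)
    fix z \<omega> :: "real ^ 'n" assume ray: "(z, \<omega>) \<in> rays"
    have "norm (xray f z \<omega>) \<le> (LBINT s. M * indicator {-\<bar>R\<bar>..\<bar>R\<bar>} s)"
      unfolding xray_def
    proof (rule Bochner_Integration.integral_norm_bound_integral)
      show "integrable lborel (\<lambda>s. f (z + s *\<^sub>R \<omega>))"
        by (rule integrable_on_line[OF assms ray])
      show "norm (f (z + s *\<^sub>R \<omega>)) \<le> M * indicator {-\<bar>R\<bar>..\<bar>R\<bar>} s" for s
        using M(2)[of "z + s *\<^sub>R \<omega>"] zero_on_line_outside[OF assms(2) ray, of s]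
        by (cases "s \<in> {-\<bar>R\<bar>..\<bar>R\<bar>}") auto
    qed simp
    also have "\<dots> = M * (2 * \<bar>R\<bar>)" by simp
    finally show "\<bar>xray f z \<omega>\<bar> \<le> M * (2 * \<bar>R\<bar>)" by simp
  qed
qed

section \<open>The energy of the data\<close>

text \<open>The constant term \<open>41/576\<close> is half the sum of the squares of the amplitudes \<open>3/8\<close> and
  \<open>1/24\<close>: each sine squared has mean \<open>1/2\<close> and the product of the two harmonics has mean \<open>0\<close>.
  All remaining terms oscillate.\<close>

lemma harmonics_square:
  fixes \<theta> :: real
  shows "(3/8 * sin \<theta> + 1/24 * sin (3 * \<theta>))\<^sup>2 =
    41/576 - 7/128 * cos (2 * \<theta>) - 1/64 * cos (4 * \<theta>) - 1/1152 * cos (6 * \<theta>)"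
proof -
  define s where "s = sin \<theta>"
  have c: "(cos \<theta>)\<^sup>2 = 1 - s\<^sup>2"
    unfolding s_def by (simp add: cos_squared_eq)
  have s3: "sin (3 * \<theta>) = 3 * s - 4 * s ^ 3"
  proof -
    have "sin (2 * \<theta> + \<theta>) = 2 * s * (cos \<theta>)\<^sup>2 + ((cos \<theta>)\<^sup>2 - s\<^sup>2) * s"
      unfolding sin_add sin_double cos_double s_def by (simp add: power2_eq_square)
    then show ?thesis unfolding c by (simp add: algebra_simps power2_eq_square power3_eq_cube)
  qed
  have c2: "cos (2 * \<theta>) = 1 - 2 * s\<^sup>2"
    unfolding cos_double c s_def[symmetric] by simp
  have c4: "cos (4 * \<theta>) = 2 * (1 - 2 * s\<^sup>2)\<^sup>2 - 1"
    using cos_double_cos[of "2 * \<theta>"] c2 by simp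
  have c6: "cos (6 * \<theta>) = 4 * (1 - 2 * s\<^sup>2) ^ 3 - 3 * (1 - 2 * s\<^sup>2)"
    using cos_treble_cos[of "2 * \<theta>"] c2 by simp
  show ?thesis
    \<comment> \<open>all terms are now polynomials in \<open>s\<close>\<close>
    unfolding s3 c2 c4 c6 s_def[symmetric] by algebra
qed

text \<open>For \<open>\<bar>s - T\<bar> \<le> \<delta>\<close> the point \<open>z + s \<omega>\<close> lies beyond \<open>ball 0 R\<close>, because \<open>T - \<delta> > R\<close>, so the
  half-line integral in the perturbation is the constant \<open>X \<alpha>(z, \<omega>)\<close> and factors out of the energy.
  The window contains the support of \<open>\<chi>(s - T)\<close>, so the remaining integral is over the whole line.
  The powers of \<open>h\<close> cancel.\<close>

lemma Data_eq:
  assumes \<alpha>: "supp \<alpha> \<subseteq> ball 0 R" and chi: "supp chi \<subseteq> {-\<delta><..<\<delta>}" and T: "T > R + \<delta>"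
    and ray: "(z, \<omega>) \<in> rays" and h: "h > 0"
  shows "Data \<alpha> chi \<delta> T h z \<omega> = \<bar>xray \<alpha> z \<omega>\<bar> *
    sqrt (LBINT \<sigma>. chi \<sigma> ^ 6 * (3/8 * sin (\<sigma> / h) + 1/24 * sin (3 * (\<sigma> / h)))\<^sup>2)"
proof -
  define X where "X = xray \<alpha> z \<omega>"
  define G where "G \<sigma> = chi \<sigma> ^ 6 * (3/8 * sin (\<sigma> / h) + 1/24 * sin (3 * (\<sigma> / h)))\<^sup>2" for \<sigma>
  have pow: "(h powr (-1/2))\<^sup>2 = 1 / h"
  proof -
    have "(h powr (-1/2))\<^sup>2 = h powr (-1/2 + -1/2)"
      by (simp only: power2_eq_square powr_add)
    then show ?thesis using h by (simp add: powr_minus_divide)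
  qed
  have "indicator {s. \<bar>s - T\<bar> \<le> \<delta>} s *\<^sub>R \<bar>delta_u \<alpha> chi \<omega> h T (z + s *\<^sub>R \<omega>)\<bar>\<^sup>2
      = X\<^sup>2 / h * G (- T + 1 * s)" for s
  proof (cases "\<bar>s - T\<bar> \<le> \<delta>")
    case True
    have \<phi>: "- T + (z + s *\<^sub>R \<omega>) \<bullet> \<omega> = s - T"
      using raysD[OF ray] by (simp add: inner_add_left dot_square_norm)
    have I: "half_line_integral \<alpha> (z + s *\<^sub>R \<omega>) \<omega> = X"
      unfolding X_def by (rule half_line_integral_eq_xray[OF \<alpha> ray]) (use True T in auto)
    have "delta_u \<alpha> chi \<omega> h T (z + s *\<^sub>R \<omega>) = h powr (-1/2) *
        (chi (s - T) ^ 3 * X * (3/8 * sin ((s - T) / h) + 1/24 * sin (3 * ((s - T) / h))))"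
      unfolding delta_u_def u_1_def u_L_def \<phi> I Let_def by (simp add: algebra_simps)
    then have "\<bar>delta_u \<alpha> chi \<omega> h T (z + s *\<^sub>R \<omega>)\<bar>\<^sup>2 = (h powr (-1/2))\<^sup>2 *
        ((chi (s - T) ^ 3)\<^sup>2 * X\<^sup>2 * (3/8 * sin ((s - T) / h) + 1/24 * sin (3 * ((s - T) / h)))\<^sup>2)"
      by (simp only: power2_abs power_mult_distrib)
    then show ?thesis
      using True unfolding pow G_def by (simp flip: power_mult)
  next
    case False
    then have "s - T \<notin> {-\<delta><..<\<delta>}" by auto
    then have "chi (s - T) = 0"
      using chi support_in_supp[of chi "s - T"] by blast
    with False show ?thesis by (simp add: G_def)
  qed
  then have "(LBINT s:{s. \<bar>s - T\<bar> \<le> \<delta>}. \<bar>delta_u \<alpha> chi \<omega> h T (z + s *\<^sub>R \<omega>)\<bar>\<^sup>2)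
      = X\<^sup>2 / h * (LBINT s. G (- T + 1 * s))"
    unfolding set_lebesgue_integral_def by (simp only: integral_mult_right_zero)
  also have "\<dots> = X\<^sup>2 / h * (LBINT \<sigma>. G \<sigma>)"
    using lborel_integral_real_affine[of 1 G "-T"] by simp
  finally show ?thesis
    using h unfolding Data_def X_def[symmetric] G_def[symmetric] by (simp add: real_sqrt_mult)
qed

text \<open>The oscillating terms of \<open>harmonics_square\<close> have frequencies \<open>2/h\<close>, \<open>4/h\<close> and \<open>6/h\<close>, and the
  moduli of their coefficients add up to less than \<open>1\<close>, so they contribute at most the bound \<open>c h\<^sup>N\<close>
  that non-stationary phase gives for frequency \<open>1/h\<close>.\<close>

lemma energy_asymptotics:
  fixes chi :: "real \<Rightarrow> real"
  assumes "C0_infinity chi" "supp chi \<subseteq> {-\<delta><..<\<delta>}"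
  obtains c where "c \<ge> 0" "\<And>h. h > 0 \<Longrightarrow> \<bar>(LBINT \<sigma>. chi \<sigma> ^ 6 * (3/8 * sin (\<sigma> / h) + 1/24 * sin (3 * (\<sigma> / h)))\<^sup>2)
      - 41/576 * (LBINT \<sigma>. chi \<sigma> ^ 6)\<bar> \<le> c * h ^ N"
proof -
  have "supp (\<lambda>\<sigma>. chi \<sigma> ^ 6) = supp chi" by (simp add: supp_def)
  then obtain c where c: "c \<ge> 0"
    "\<And>\<mu> p. \<mu> > 0 \<Longrightarrow> \<bar>LBINT \<sigma>. chi \<sigma> ^ 6 * cos (\<mu> * \<sigma> + p)\<bar> \<le> c / \<mu> ^ N"
    using non_stationary_phase[of N "\<lambda>\<sigma>. chi \<sigma> ^ 6" "-\<delta>" \<delta>]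
      Ck_power[OF C0_infinityD(3)[OF assms(1)], of N 6] assms(2) by metis
  have "\<bar>(LBINT \<sigma>. chi \<sigma> ^ 6 * (3/8 * sin (\<sigma> / h) + 1/24 * sin (3 * (\<sigma> / h)))\<^sup>2)
      - 41/576 * (LBINT \<sigma>. chi \<sigma> ^ 6)\<bar> \<le> c * h ^ N" if h: "h > 0" for h
  proof -
    define J where "J k = (LBINT \<sigma>. chi \<sigma> ^ 6 * cos (k * (\<sigma> / h)))" for k
    have int: "integrable lborel (\<lambda>\<sigma>. chi \<sigma> ^ 6 * cos (k * (\<sigma> / h)))" for k
      by (rule integrable_continuous_compact_support[of _ "supp chi"])
        (use h in \<open>auto intro!: continuous_intros C0_infinityD[OF assms(1)] simp: eq_0_outside_supp\<close>)
    have int0: "integrable lborel (\<lambda>\<sigma>. chi \<sigma> ^ 6)"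
      using int[of 0] by simp
    have J: "\<bar>J k\<bar> \<le> c * h ^ N" if "k \<ge> 1" for k
    proof -
      have "\<bar>J k\<bar> \<le> c / (k / h) ^ N"
        using c(2)[of "k / h" 0] h that by (simp add: J_def)
      also have "\<dots> = c * h ^ N / k ^ N"
        using h by (simp add: power_divide)
      also have "\<dots> \<le> c * h ^ N"
        using c(1) h that by (intro divide_left_mono[of 1 "k ^ N" "c * h ^ N", simplified] one_le_power) auto
      finally show ?thesis .
    qed
    have "(LBINT \<sigma>. chi \<sigma> ^ 6 * (3/8 * sin (\<sigma> / h) + 1/24 * sin (3 * (\<sigma> / h)))\<^sup>2)
        = (LBINT \<sigma>. 41/576 * chi \<sigma> ^ 6 - 7/128 * (chi \<sigma> ^ 6 * cos (2 * (\<sigma> / h)))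
            - 1/64 * (chi \<sigma> ^ 6 * cos (4 * (\<sigma> / h))) - 1/1152 * (chi \<sigma> ^ 6 * cos (6 * (\<sigma> / h))))"
      unfolding harmonics_square by (simp only: algebra_simps)
    also have "\<dots> = 41/576 * (LBINT \<sigma>. chi \<sigma> ^ 6) - 7/128 * J 2 - 1/64 * J 4 - 1/1152 * J 6"
      unfolding J_def using int int0 by simp
    finally show ?thesis
      using J[of 2] J[of 4] J[of 6] by (simp add: abs_le_iff)
  qed
  then show ?thesis by (rule that[OF c(1)])
qed

lemma abs_sqrt_diff_le:
  assumes "a \<ge> 0" "b > 0"
  shows "\<bar>sqrt a - sqrt b\<bar> \<le> \<bar>a - b\<bar> / sqrt b"
proof -
  have "\<bar>sqrt a - sqrt b\<bar> * sqrt b \<le> \<bar>sqrt a - sqrt b\<bar> * (sqrt a + sqrt b)"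
    using assms by (intro mult_left_mono) auto
  also have "\<dots> = \<bar>(sqrt a - sqrt b) * (sqrt a + sqrt b)\<bar>"
    using assms by (simp add: abs_mult)
  also have "(sqrt a - sqrt b) * (sqrt a + sqrt b) = a - b"
    using assms by (simp add: algebra_simps)
  finally show ?thesis
    using assms by (simp add: pos_le_divide_eq)
qed

lemma C_const_eq: "C_const chi = sqrt (41/576 * (LBINT \<sigma>. chi \<sigma> ^ 6))"
proof -
  have "sqrt 576 = (24::real)" by (rule real_sqrt_unique) auto
  then show ?thesis by (simp add: C_const_def real_sqrt_mult real_sqrt_divide)
qed

lemma C_const_pos:
  fixes chi :: "real \<Rightarrow> real"
  assumes "C0_infinity chi" "\<exists>\<sigma>. chi \<sigma> \<noteq> 0"
  shows "C_const chi > 0"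
proof -
  have cont: "continuous_on UNIV (\<lambda>\<sigma>. chi \<sigma> ^ 6)"
    by (intro continuous_intros C0_infinityD[OF assms(1)])
  have int: "integrable lborel (\<lambda>\<sigma>. chi \<sigma> ^ 6)"
    by (rule integrable_continuous_compact_support[OF cont C0_infinityD(2)[OF assms(1)]])
      (simp add: eq_0_outside_supp)
  have "(LBINT \<sigma>. chi \<sigma> ^ 6) \<noteq> 0"
    using continuous_integral_nonneg_eq_0_imp_eq_0[OF cont int] assms(2) by auto
  moreover have "(LBINT \<sigma>. chi \<sigma> ^ 6) \<ge> 0"
    by (intro integral_nonneg_AE) auto
  ultimately have "(LBINT \<sigma>. chi \<sigma> ^ 6) > 0" by linarith
  then show ?thesis by (simp add: C_const_def)
qed

text \<open>The data is the square root of a quantity with a known expansion. The square root is Lipschitz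
  near the limit, because the limit of the energy is positive: this is where \<open>\<chi> \<noteq> 0\<close> enters.\<close>

lemma Data_asymptotics:
  assumes \<alpha>: "supp \<alpha> \<subseteq> ball 0 R" and chi: "C0_infinity chi" "\<exists>\<sigma>. chi \<sigma> \<noteq> 0" "supp chi \<subseteq> {-\<delta><..<\<delta>}"
    and T: "T > R + \<delta>"
  obtains c where "c \<ge> 0" "\<And>h z \<omega>. h > 0 \<Longrightarrow> (z, \<omega>) \<in> rays \<Longrightarrow>
    \<bar>Data \<alpha> chi \<delta> T h z \<omega> - C_const chi * \<bar>xray \<alpha> z \<omega>\<bar>\<bar> \<le> \<bar>xray \<alpha> z \<omega>\<bar> * (c * h ^ N)"
proof -
  define E where "E h = (LBINT \<sigma>. chi \<sigma> ^ 6 * (3/8 * sin (\<sigma> / h) + 1/24 * sin (3 * (\<sigma> / h)))\<^sup>2)" for h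
  define D where "D = 41/576 * (LBINT \<sigma>. chi \<sigma> ^ 6)"
  have C: "C_const chi = sqrt D" by (simp add: C_const_eq D_def)
  have D: "D > 0" using C_const_pos[OF chi(1,2)] by (simp add: C)
  have E: "E h \<ge> 0" for h unfolding E_def by (intro integral_nonneg_AE) auto
  obtain c where c: "c \<ge> 0" "\<And>h. h > 0 \<Longrightarrow> \<bar>E h - D\<bar> \<le> c * h ^ N"
    using energy_asymptotics[OF chi(1,3), of N] unfolding E_def D_def by blast
  have "\<bar>Data \<alpha> chi \<delta> T h z \<omega> - C_const chi * \<bar>xray \<alpha> z \<omega>\<bar>\<bar> \<le> \<bar>xray \<alpha> z \<omega>\<bar> * (c / sqrt D * h ^ N)"
    if h: "h > 0" and ray: "(z, \<omega>) \<in> rays" for h z \<omega>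
  proof -
    have "Data \<alpha> chi \<delta> T h z \<omega> - C_const chi * \<bar>xray \<alpha> z \<omega>\<bar>
        = \<bar>xray \<alpha> z \<omega>\<bar> * (sqrt (E h) - sqrt D)"
      unfolding Data_eq[OF \<alpha> chi(3) T ray h] C E_def by (simp add: algebra_simps)
    moreover have "\<bar>sqrt (E h) - sqrt D\<bar> \<le> c / sqrt D * h ^ N"
    proof -
      have "\<bar>sqrt (E h) - sqrt D\<bar> \<le> \<bar>E h - D\<bar> / sqrt D" by (rule abs_sqrt_diff_le[OF E D])
      also have "\<dots> \<le> c * h ^ N / sqrt D" using c(2)[OF h] D by (intro divide_right_mono) auto
      finally show ?thesis by simp
    qed
    ultimately show ?thesis by (simp only: abs_mult abs_abs) (intro mult_left_mono abs_ge_zero)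
  qed
  moreover have "c / sqrt D \<ge> 0" using c(1) D by simp
  ultimately show ?thesis using that by blast
qed

lemma Data_tendsto:
  assumes "supp \<alpha> \<subseteq> ball 0 R" "C0_infinity chi" "\<exists>\<sigma>. chi \<sigma> \<noteq> 0" "supp chi \<subseteq> {-\<delta><..<\<delta>}"
    and "T > R + \<delta>" and ray: "(z, \<omega>) \<in> rays"
  shows "((\<lambda>h. Data \<alpha> chi \<delta> T h z \<omega>) \<longlongrightarrow> C_const chi * \<bar>xray \<alpha> z \<omega>\<bar>) (at_right 0)"
proof -
  obtain c where c: "c \<ge> 0" "\<And>h. h > 0 \<Longrightarrow>
      \<bar>Data \<alpha> chi \<delta> T h z \<omega> - C_const chi * \<bar>xray \<alpha> z \<omega>\<bar>\<bar> \<le> \<bar>xray \<alpha> z \<omega>\<bar> * (c * h ^ 1)"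
    by (rule Data_asymptotics[OF assms(1-5), of 1]) (use ray in blast)
  have "((\<lambda>h. Data \<alpha> chi \<delta> T h z \<omega> - C_const chi * \<bar>xray \<alpha> z \<omega>\<bar>) \<longlongrightarrow> 0) (at_right 0)"
  proof (rule Lim_null_comparison)
    show "\<forall>\<^sub>F h in at_right 0. norm (Data \<alpha> chi \<delta> T h z \<omega> - C_const chi * \<bar>xray \<alpha> z \<omega>\<bar>)
        \<le> \<bar>xray \<alpha> z \<omega>\<bar> * (c * h)"
      using eventually_at_right_less[of "0::real"] by eventually_elim (use c(2) in auto)
    show "((\<lambda>h. \<bar>xray \<alpha> z \<omega>\<bar> * (c * h)) \<longlongrightarrow> 0) (at_right 0)"
      by (auto intro!: tendsto_eq_intros)
  qed
  then show ?thesis by (simp add: LIM_zero_iff)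
qed

lemma Data_O_h_infinity:
  assumes \<alpha>: "C0_infinity \<alpha>" "supp \<alpha> \<subseteq> ball 0 R"
    and chi: "C0_infinity chi" "\<exists>\<sigma>. chi \<sigma> \<noteq> 0" "supp chi \<subseteq> {-\<delta><..<\<delta>}" and T: "T > R + \<delta>"
  shows "O_h_infinity_on rays
    (\<lambda>h (z, \<omega>). Data \<alpha> chi \<delta> T h z \<omega> - C_const chi * \<bar>xray \<alpha> z \<omega>\<bar>)"
  unfolding O_h_infinity_on_def
proof
  fix N :: nat
  obtain B where B: "\<And>z \<omega>. (z, \<omega>) \<in> rays \<Longrightarrow> \<bar>xray \<alpha> z \<omega>\<bar> \<le> B"
    using xray_bounded[OF \<alpha>] by blast
  obtain c where c: "c \<ge> 0" "\<And>h z \<omega>. h > 0 \<Longrightarrow> (z, \<omega>) \<in> rays \<Longrightarrow>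
      \<bar>Data \<alpha> chi \<delta> T h z \<omega> - C_const chi * \<bar>xray \<alpha> z \<omega>\<bar>\<bar> \<le> \<bar>xray \<alpha> z \<omega>\<bar> * (c * h ^ N)"
    using Data_asymptotics[OF \<alpha>(2) chi T, of N] by blast
  have bound: "\<bar>Data \<alpha> chi \<delta> T h z \<omega> - C_const chi * \<bar>xray \<alpha> z \<omega>\<bar>\<bar> \<le> B * c * \<bar>h ^ N\<bar>"
    if "h > 0" "(z, \<omega>) \<in> rays" for h z \<omega>
  proof -
    have "\<bar>xray \<alpha> z \<omega>\<bar> * (c * h ^ N) \<le> B * (c * h ^ N)"
      using B[OF that(2)] c(1) that(1) by (intro mult_right_mono) auto
    then show ?thesis using c(2)[OF that] that(1) by (simp add: mult.assoc)
  qed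
  have "\<forall>\<^sub>F hp in at_right (0::real) \<times>\<^sub>F principal rays. 0 < fst hp \<and> snd hp \<in> rays"
    by (intro eventually_prodI eventually_at_right_less) (simp add: eventually_principal)
  then show "(\<lambda>(h, p). case p of (z, \<omega>) \<Rightarrow> Data \<alpha> chi \<delta> T h z \<omega> - C_const chi * \<bar>xray \<alpha> z \<omega>\<bar>)
      \<in> O[at_right 0 \<times>\<^sub>F principal rays](\<lambda>(h, p). h ^ N)"
    by (intro bigoI[where c = "B * c"], eventually_elim) (use bound in \<open>auto split: prod.splits\<close>)
qed

section \<open>Injectivity of the X-ray transform\<close>

lemma lborel_integral_translation:
  fixes f :: "'a::euclidean_space \<Rightarrow> real"
  assumes "f \<in> borel_measurable borel"
  shows "(LBINT x. f (c + x)) = (LBINT x. f x)"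
proof -
  have "(LBINT x. f x) = integral\<^sup>L (distr lborel borel ((+) c)) f"
    by (simp add: lborel_distr_plus)
  also have "\<dots> = (LBINT x. f (c + x))"
    using assms by (intro integral_distr) auto
  finally show ?thesis by simp
qed

text \<open>Instead of rotating coordinates to split off the direction \<open>\<omega>\<close>, weight the vanishing line
  integrals with \<open>w (z \<bullet> \<omega>)\<close>, where \<open>w\<close> is the indicator of \<open>{0..1}\<close>, and integrate over all \<open>z\<close>.
  Exchanging the integrals and translating by \<open>s \<omega>\<close> moves the parameter \<open>s\<close> from \<open>g\<close> to the weight:
  \<open>\<integral>\<integral> w (z \<bullet> \<omega>) g (z + s \<omega>) ds dz = \<integral>\<integral> w (x \<bullet> \<omega> - s) g x dx ds = (\<integral> w) (\<integral> g)\<close>, and \<open>w\<close> has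
  integral \<open>1\<close>. The weight also makes the double integral absolutely convergent.\<close>

lemma integral_eq_0_if_line_integrals_eq_0:
  fixes g :: "'a::euclidean_space \<Rightarrow> real"
  assumes cont: "continuous_on UNIV g" and supp: "\<And>x. norm x > R \<Longrightarrow> g x = 0"
    and \<omega>: "norm \<omega> = 1" and line: "\<And>z. (LBINT s. g (z + s *\<^sub>R \<omega>)) = 0"
  shows "(LBINT x. g x) = 0"
proof -
  define w :: "real \<Rightarrow> real" where "w = indicator {0..1}"
  have [measurable]: "g \<in> borel_measurable borel" "w \<in> borel_measurable borel"
    using cont by (simp_all add: borel_measurable_continuous_onI w_def)
  obtain M where M: "M \<ge> 0" "\<And>x. \<bar>g x\<bar> \<le> M"
    using continuous_compact_support_bounded[OF cont compact_cball[of 0 R]] supp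
    by (metis mem_cball_0 not_le)
  have bound: "\<bar>w a * g x\<bar> \<le> M" for a x
    using M by (simp add: w_def indicator_def)
  have inner: "(z + s *\<^sub>R \<omega>) \<bullet> \<omega> = z \<bullet> \<omega> + s" for z s
    using \<omega> by (simp add: inner_add_left dot_square_norm)
  \<comment> \<open>the weight keeps \<open>s\<close> within distance 1 of the component of \<open>x\<close> along \<open>\<omega>\<close>\<close>
  have s_bound: "\<bar>s\<bar> \<le> R + 1" if "w (x \<bullet> \<omega> - s) * g x \<noteq> 0" for x s
  proof -
    have "norm x \<le> R" using that supp[of x] by (cases "norm x \<le> R") auto
    moreover have "\<bar>x \<bullet> \<omega> - s\<bar> \<le> 1" using that by (auto simp: w_def indicator_def split: if_splits)
    ultimately show ?thesis using Cauchy_Schwarz_ineq2[of x \<omega>] \<omega> by simp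
  qed
  have x_bound: "norm x \<le> R" if "w (x \<bullet> \<omega> - s) * g x \<noteq> 0" for x s
    using that supp[of x] by (cases "norm x \<le> R") auto
  have int: "integrable (lborel \<Otimes>\<^sub>M lborel) (\<lambda>(z, s). w (z \<bullet> \<omega>) * g (z + s *\<^sub>R \<omega>))"
    unfolding lborel_prod
  proof (rule integrableI_bounded_set[of "cball 0 (2 * R + 1) \<times> cball 0 (R + 1)" _ _ M])
    show "emeasure lborel (cball (0::'a) (2 * R + 1) \<times> cball (0::real) (R + 1)) < \<infinity>"
      by (intro emeasure_bounded_finite bounded_Times) auto
    show "AE p in lborel. p \<notin> cball 0 (2 * R + 1) \<times> cball 0 (R + 1) \<longrightarrow>
        (case p of (z, s) \<Rightarrow> w (z \<bullet> \<omega>) * g (z + s *\<^sub>R \<omega>)) = 0"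
    proof (intro AE_I2 impI)
      fix p :: "'a \<times> real"
      assume out: "p \<notin> cball 0 (2 * R + 1) \<times> cball 0 (R + 1)"
      obtain z s where p: "p = (z, s)" by (cases p)
      have "w (z \<bullet> \<omega>) * g (z + s *\<^sub>R \<omega>) = 0"
      proof (rule ccontr)
        assume "w (z \<bullet> \<omega>) * g (z + s *\<^sub>R \<omega>) \<noteq> 0"
        then have nz: "w ((z + s *\<^sub>R \<omega>) \<bullet> \<omega> - s) * g (z + s *\<^sub>R \<omega>) \<noteq> 0" by (simp add: inner)
        have "norm z \<le> norm (z + s *\<^sub>R \<omega>) + norm (s *\<^sub>R \<omega>)"
          using norm_triangle_ineq4[of "z + s *\<^sub>R \<omega>" "s *\<^sub>R \<omega>"] by simp
        with s_bound[OF nz] x_bound[OF nz] \<omega> out p show False by simp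
      qed
      then show "(case p of (z, s) \<Rightarrow> w (z \<bullet> \<omega>) * g (z + s *\<^sub>R \<omega>)) = 0" by (simp add: p)
    qed
    show "cball 0 (2 * R + 1) \<times> cball 0 (R + 1) \<in> sets (lborel :: ('a \<times> real) measure)"
      by (simp add: borel_closed closed_Times)
    have "(\<lambda>(z, s). w (z \<bullet> \<omega>) * g (z + s *\<^sub>R \<omega>)) \<in> borel_measurable (borel \<Otimes>\<^sub>M borel)"
      by measurable
    then show "(\<lambda>(z, s). w (z \<bullet> \<omega>) * g (z + s *\<^sub>R \<omega>)) \<in> borel_measurable lborel"
      by (simp add: borel_prod)
    show "AE p in lborel. p \<in> cball 0 (2 * R + 1) \<times> cball 0 (R + 1) \<longrightarrow>
        norm (case p of (z, s) \<Rightarrow> w (z \<bullet> \<omega>) * g (z + s *\<^sub>R \<omega>)) \<le> M"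
      using bound by (auto split: prod.splits)
  qed
  have int': "integrable (lborel \<Otimes>\<^sub>M lborel) (\<lambda>(x, s). w (x \<bullet> \<omega> - s) * g x)"
    unfolding lborel_prod
  proof (rule integrableI_bounded_set[of "cball 0 R \<times> cball 0 (R + 1)" _ _ M])
    show "emeasure lborel (cball (0::'a) R \<times> cball (0::real) (R + 1)) < \<infinity>"
      by (intro emeasure_bounded_finite bounded_Times) auto
    show "AE p in lborel. p \<notin> cball 0 R \<times> cball 0 (R + 1) \<longrightarrow>
        (case p of (x, s) \<Rightarrow> w (x \<bullet> \<omega> - s) * g x) = 0"
    proof (intro AE_I2 impI)
      fix p :: "'a \<times> real"
      assume out: "p \<notin> cball 0 R \<times> cball 0 (R + 1)"
      obtain x s where p: "p = (x, s)" by (cases p)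
      have "w (x \<bullet> \<omega> - s) * g x = 0"
        using s_bound[of x s] x_bound[of x s] out p by fastforce
      then show "(case p of (x, s) \<Rightarrow> w (x \<bullet> \<omega> - s) * g x) = 0" by (simp add: p)
    qed
    show "cball 0 R \<times> cball 0 (R + 1) \<in> sets (lborel :: ('a \<times> real) measure)"
      by (simp add: borel_closed closed_Times)
    have "(\<lambda>(x, s). w (x \<bullet> \<omega> - s) * g x) \<in> borel_measurable (borel \<Otimes>\<^sub>M borel)"
      by measurable
    then show "(\<lambda>(x, s). w (x \<bullet> \<omega> - s) * g x) \<in> borel_measurable lborel"
      by (simp add: borel_prod)
    show "AE p in lborel. p \<in> cball 0 R \<times> cball 0 (R + 1) \<longrightarrow>
        norm (case p of (x, s) \<Rightarrow> w (x \<bullet> \<omega> - s) * g x) \<le> M"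
      using bound by (auto split: prod.splits)
  qed
  have w_int: "(LBINT s. w (a - s)) = 1" for a
  proof -
    have "(LBINT s. w (a - s)) = (LBINT s. w s)"
      using lborel_integral_real_affine[of "-1" w a] by simp
    then show ?thesis by (simp add: w_def)
  qed
  have "(LBINT x. g x) = (LBINT x. LBINT s. w (x \<bullet> \<omega> - s) * g x)"
    by (simp add: w_int)
  also have "\<dots> = (LBINT s. LBINT x. w (x \<bullet> \<omega> - s) * g x)"
    by (rule lborel_pair.Fubini_integral[symmetric]) (rule int')
  also have "\<dots> = (LBINT s. LBINT z. w (z \<bullet> \<omega>) * g (z + s *\<^sub>R \<omega>))"
  proof (rule Bochner_Integration.integral_cong[OF refl])
    fix s :: real
    have "(LBINT x. w (x \<bullet> \<omega> - s) * g x)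
        = (LBINT z. w ((s *\<^sub>R \<omega> + z) \<bullet> \<omega> - s) * g (s *\<^sub>R \<omega> + z))"
      by (rule lborel_integral_translation[symmetric]) measurable
    then show "(LBINT x. w (x \<bullet> \<omega> - s) * g x) = (LBINT z. w (z \<bullet> \<omega>) * g (z + s *\<^sub>R \<omega>))"
      using inner by (simp add: add.commute)
  qed
  also have "\<dots> = (LBINT z. LBINT s. w (z \<bullet> \<omega>) * g (z + s *\<^sub>R \<omega>))"
    by (rule lborel_pair.Fubini_integral) (rule int)
  also have "\<dots> = 0"
    by (simp add: line)
  finally show ?thesis .
qed

text \<open>Finite sums of real exponentials of linear functionals. A generator carries its coefficient, so
  constants and products of generators are generators.\<close>

inductive_set exp_sums :: "('a::euclidean_space \<Rightarrow> real) set" where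
  exp: "(\<lambda>x. c * exp (\<xi> \<bullet> x)) \<in> exp_sums"
| add: "f \<in> exp_sums \<Longrightarrow> g \<in> exp_sums \<Longrightarrow> (\<lambda>x. f x + g x) \<in> exp_sums"

lemma exp_sums_continuous: "f \<in> exp_sums \<Longrightarrow> continuous_on S f"
  by (induction rule: exp_sums.induct) (auto intro!: continuous_intros)

lemma exp_sums_mult: "f \<in> exp_sums \<Longrightarrow> g \<in> exp_sums \<Longrightarrow> (\<lambda>x. f x * g x) \<in> exp_sums"
proof (induction rule: exp_sums.induct)
  case (exp c \<xi>)
  from exp show ?case
  proof (induction rule: exp_sums.induct)
    case (exp d \<eta>)
    have "(\<lambda>x. c * exp (\<xi> \<bullet> x) * (d * exp (\<eta> \<bullet> x))) = (\<lambda>x. (c * d) * exp ((\<xi> + \<eta>) \<bullet> x))"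
      by (simp add: inner_add_left exp_add fun_eq_iff)
    then show ?case by (simp only: exp_sums.exp)
  next
    case (add f g)
    then show ?case by (simp only: distrib_left exp_sums.add)
  qed
next
  case (add f1 f2)
  then show ?case by (simp only: distrib_right exp_sums.add)
qed

lemma exp_sums_function_ring: "compact S \<Longrightarrow> function_ring_on exp_sums (S :: 'a::euclidean_space set)"
proof
  show "(\<lambda>_. c) \<in> exp_sums" for c
    using exp_sums.exp[of c 0] by simp
  show "\<exists>f\<in>exp_sums. f x \<noteq> f y" if "x \<noteq> y" for x y :: 'a
  proof (rule bexI)
    have "(x - y) \<bullet> (x - y) \<noteq> 0" using that by simp
    then have "(x - y) \<bullet> x \<noteq> (x - y) \<bullet> y" unfolding inner_diff_right by simp
    then show "1 * exp ((x - y) \<bullet> x) \<noteq> 1 * exp ((x - y) \<bullet> y)" by simp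
  qed (rule exp_sums.exp)
qed (auto intro: exp_sums_continuous exp_sums.add exp_sums_mult)

text \<open>If \<open>f\<close> is orthogonal to all exponentials, it is orthogonal to functions that, by Stone and
  Weierstrass, approximate \<open>f\<close> itself uniformly on \<open>K\<close>. Hence \<open>f\<close> is orthogonal to
  itself.\<close>

lemma eq_0_if_Laplace_transform_eq_0:
  fixes f :: "'a::euclidean_space \<Rightarrow> real"
  assumes cont: "continuous_on UNIV f" and K: "compact K" and supp: "\<And>x. x \<notin> K \<Longrightarrow> f x = 0"
    and zero: "\<And>\<xi>. (LBINT x. f x * exp (\<xi> \<bullet> x)) = 0"
  shows "f x = 0"
proof -
  have int: "integrable lborel (\<lambda>x. f x * g x)" if "continuous_on UNIV g" for g
    using supp by (intro integrable_continuous_compact_support[OF _ K] continuous_intros cont that) simp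
  have orth: "(LBINT x. f x * g x) = 0" if "g \<in> exp_sums" for g
    using that
  proof (induction rule: exp_sums.induct)
    case (exp c \<xi>)
    have "(LBINT x. f x * (c * exp (\<xi> \<bullet> x))) = c * (LBINT x. f x * exp (\<xi> \<bullet> x))"
      by (simp add: mult.left_commute)
    then show ?case by (simp add: zero)
  next
    case (add g h)
    then show ?case
      by (simp add: distrib_left int exp_sums_continuous)
  qed
  have int_abs: "integrable lborel (\<lambda>x. \<bar>f x\<bar>)"
    using int[of "\<lambda>_. 1"] by simp
  define L where "L = (LBINT x. \<bar>f x\<bar>)"
  have L: "L \<ge> 0" unfolding L_def by (intro integral_nonneg_AE) auto
  have small: "(LBINT x. f x * f x) \<le> e * L" if e: "e > 0" for e
  proof -
    interpret function_ring_on exp_sums K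
      by (rule exp_sums_function_ring[OF K])
    obtain g where g: "g \<in> exp_sums" "\<And>x. x \<in> K \<Longrightarrow> \<bar>f x - g x\<bar> < e"
      using Stone_Weierstrass_basic[OF continuous_on_subset[OF cont] e] by auto
    have "(LBINT x. f x * f x) = (LBINT x. f x * (f x - g x))"
      using orth[OF g(1)] int[OF cont] int[OF exp_sums_continuous[OF g(1)]]
      by (simp add: right_diff_distrib)
    also have "\<dots> \<le> (LBINT x. e * \<bar>f x\<bar>)"
    proof (rule integral_mono)
      show "integrable lborel (\<lambda>x. f x * (f x - g x))"
        by (intro int continuous_intros cont exp_sums_continuous[OF g(1)])
      show "integrable lborel (\<lambda>x. e * \<bar>f x\<bar>)"
        using int_abs by simp
      fix x
      show "f x * (f x - g x) \<le> e * \<bar>f x\<bar>"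
      proof (cases "x \<in> K")
        case True
        have "f x * (f x - g x) \<le> \<bar>f x\<bar> * \<bar>f x - g x\<bar>"
          by (metis abs_ge_self abs_mult)
        also have "\<dots> \<le> \<bar>f x\<bar> * e"
          using g(2)[OF True] by (intro mult_left_mono) auto
        finally show ?thesis by (simp add: mult.commute)
      qed (simp add: supp)
    qed
    finally show ?thesis by (simp add: L_def)
  qed
  have "(LBINT x. f x * f x) \<le> 0"
  proof (rule field_le_epsilon)
    fix e :: real assume e: "e > 0"
    have "(LBINT x. f x * f x) \<le> e / (L + 1) * L" using e L by (intro small) simp
    also have "\<dots> \<le> e" using e L by (simp add: field_simps)
    finally show "(LBINT x. f x * f x) \<le> 0 + e" by simp
  qed
  moreover have "(LBINT x. f x * f x) \<ge> 0" by (intro integral_nonneg_AE) auto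
  ultimately have "f x * f x = 0"
    by (intro continuous_integral_nonneg_eq_0_imp_eq_0[of "\<lambda>x. f x * f x"] int cont continuous_intros) auto
  then show ?thesis by simp
qed

text \<open>A version of the Fourier slice theorem with real exponentials: for \<open>\<xi>\<close> orthogonal to \<open>\<omega>\<close> the
  factor \<open>exp (\<xi> \<bullet> x)\<close> is constant on the lines in direction \<open>\<omega>\<close>, so the line integrals of
  \<open>f x * exp (\<xi> \<bullet> x)\<close> vanish together with those of \<open>f\<close>. In dimension at least two every \<open>\<xi>\<close> has such
  a direction \<open>\<omega>\<close>.\<close>

theorem xray_injective:
  fixes \<alpha> \<beta> :: "real ^ 'n \<Rightarrow> real"
  assumes n: "CARD('n) \<ge> 2"
    and \<alpha>: "C0_infinity \<alpha>" "supp \<alpha> \<subseteq> ball 0 R" and \<beta>: "C0_infinity \<beta>" "supp \<beta> \<subseteq> ball 0 R"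
    and eq: "\<And>z \<omega>. (z, \<omega>) \<in> rays \<Longrightarrow> xray \<beta> z \<omega> = xray \<alpha> z \<omega>"
  shows "\<beta> = \<alpha>"
proof
  fix x
  define f where "f x = \<beta> x - \<alpha> x" for x
  have cont: "continuous_on UNIV f"
    unfolding f_def by (intro continuous_intros C0_infinityD(1) \<alpha> \<beta>)
  have f0: "f y = 0" if "norm y > R" for y
  proof -
    have "y \<notin> ball 0 R" using that by simp
    then have "y \<notin> supp \<alpha>" "y \<notin> supp \<beta>" using \<alpha>(2) \<beta>(2) by blast+
    then show ?thesis by (simp add: f_def eq_0_outside_supp)
  qed
  have "f x = 0"
  proof (rule eq_0_if_Laplace_transform_eq_0[OF cont compact_cball[of 0 R]])
    show "f y = 0" if "y \<notin> cball 0 R" for y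
      using that by (intro f0) simp
    fix \<xi> :: "real ^ 'n"
    obtain v :: "real ^ 'n" where v: "v \<noteq> 0" "orthogonal \<xi> v"
      using orthogonal_to_vector_exists[of \<xi>] n by auto
    define \<omega> where "\<omega> = v /\<^sub>R norm v"
    have \<omega>: "norm \<omega> = 1" "\<xi> \<bullet> \<omega> = 0"
      using v by (simp_all add: \<omega>_def orthogonal_def)
    define g where "g x = f x * exp (\<xi> \<bullet> x)" for x
    have "(LBINT x. g x) = 0"
    proof (rule integral_eq_0_if_line_integrals_eq_0[OF _ _ \<omega>(1)])
      show "continuous_on UNIV g"
        unfolding g_def by (intro continuous_intros cont)
      show "g y = 0" if "norm y > R" for y
        using f0[OF that] by (simp add: g_def)
      fix z :: "real ^ 'n"
      \<comment> \<open>the foot of the line through \<open>z\<close> in the hyperplane orthogonal to \<open>\<omega>\<close>\<close>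
      define y where "y = z - (z \<bullet> \<omega>) *\<^sub>R \<omega>"
      have ray: "(y, \<omega>) \<in> rays"
        using \<omega>(1) by (simp add: rays_def y_def inner_diff_left dot_square_norm)
      have "g (y + s *\<^sub>R \<omega>) = exp (\<xi> \<bullet> y) * (\<beta> (y + s *\<^sub>R \<omega>) - \<alpha> (y + s *\<^sub>R \<omega>))" for s
        using \<omega>(2) by (simp add: g_def f_def inner_add_right)
      then have "xray g y \<omega> = exp (\<xi> \<bullet> y) * (LBINT s. \<beta> (y + s *\<^sub>R \<omega>) - \<alpha> (y + s *\<^sub>R \<omega>))"
        by (simp only: xray_def integral_mult_right_zero)
      also have "(LBINT s. \<beta> (y + s *\<^sub>R \<omega>) - \<alpha> (y + s *\<^sub>R \<omega>)) = xray \<beta> y \<omega> - xray \<alpha> y \<omega>"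
        unfolding xray_def
        by (intro Bochner_Integration.integral_diff integrable_on_line[OF \<alpha> ray] integrable_on_line[OF \<beta> ray])
      finally have "xray g y \<omega> = 0" using eq[OF ray] by simp
      moreover have "xray g z \<omega> = xray g y \<omega>"
        using xray_shift[of g y "z \<bullet> \<omega>" \<omega>] by (simp add: y_def)
      ultimately show "(LBINT s. g (z + s *\<^sub>R \<omega>)) = 0"
        by (simp add: xray_def)
    qed
    then show "(LBINT x. f x * exp (\<xi> \<bullet> x)) = 0"
      by (simp add: g_def)
  qed
  then show "\<beta> x = \<alpha> x" by (simp add: f_def)
qed

section \<open>Recovery of the potential\<close>

theorem theorem5p1:
  fixes \<alpha> :: "real ^ 'n \<Rightarrow> real" and chi :: "real \<Rightarrow> real" and R \<delta> T :: real
  assumes "CARD('n) \<ge> 2"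
    and "C0_infinity \<alpha>" and "\<And>x. \<alpha> x \<ge> 0" and "supp \<alpha> \<subseteq> ball 0 R"
    and "C0_infinity chi" and "\<And>\<sigma>. chi \<sigma> \<ge> 0" and "\<exists>\<sigma>. chi \<sigma> \<noteq> 0" and "supp chi \<subseteq> {-\<delta><..<\<delta>}"
    and "T > R + \<delta>"
  shows "O_h_infinity_on rays
           (\<lambda>h (z, \<omega>). Data \<alpha> chi \<delta> T h z \<omega> - C_const chi * \<bar>xray \<alpha> z \<omega>\<bar>)
       \<and> C_const chi > 0
       \<and> (\<forall>(z, \<omega>) \<in> rays. \<exists>L. ((\<lambda>h. Data \<alpha> chi \<delta> T h z \<omega>) \<longlongrightarrow> L) (at_right 0)
             \<and> xray \<alpha> z \<omega> = inverse (C_const chi) * L)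
       \<and> (\<forall>\<beta> :: real ^ 'n \<Rightarrow> real.
             C0_infinity \<beta> \<longrightarrow> (\<forall>x. \<beta> x \<ge> 0) \<longrightarrow> supp \<beta> \<subseteq> ball 0 R \<longrightarrow>
             (\<forall>(z, \<omega>) \<in> rays. Lim (at_right 0) (\<lambda>h. Data \<beta> chi \<delta> T h z \<omega>)
                              = Lim (at_right 0) (\<lambda>h. Data \<alpha> chi \<delta> T h z \<omega>)) \<longrightarrow>
             \<beta> = \<alpha>)"
proof (intro conjI)
  note data = assms(5,7,8,9)
  have nonneg: "\<bar>xray f z \<omega>\<bar> = xray f z \<omega>" if "\<And>x. f x \<ge> 0" for f :: "real ^ 'n \<Rightarrow> real" and z \<omega>
    using that by (simp add: xray_def)
  have lim: "((\<lambda>h. Data f chi \<delta> T h z \<omega>) \<longlongrightarrow> C_const chi * xray f z \<omega>) (at_right 0)"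
    if "\<And>x. f x \<ge> 0" "supp f \<subseteq> ball 0 R" "(z, \<omega>) \<in> rays" for f :: "real ^ 'n \<Rightarrow> real" and z \<omega>
    using Data_tendsto[OF that(2) data that(3)] by (simp only: nonneg[OF that(1)])
  show pos: "C_const chi > 0"
    by (rule C_const_pos[OF assms(5,7)])
  show "O_h_infinity_on rays
      (\<lambda>h (z, \<omega>). Data \<alpha> chi \<delta> T h z \<omega> - C_const chi * \<bar>xray \<alpha> z \<omega>\<bar>)"
    by (rule Data_O_h_infinity[OF assms(2,4) data])
  show "\<forall>(z, \<omega>) \<in> rays. \<exists>L. ((\<lambda>h. Data \<alpha> chi \<delta> T h z \<omega>) \<longlongrightarrow> L) (at_right 0)
      \<and> xray \<alpha> z \<omega> = inverse (C_const chi) * L"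
  proof (clarify)
    fix z \<omega> :: "real ^ 'n" assume "(z, \<omega>) \<in> rays"
    from lim[OF assms(3,4) this] pos
    show "\<exists>L. ((\<lambda>h. Data \<alpha> chi \<delta> T h z \<omega>) \<longlongrightarrow> L) (at_right 0) \<and> xray \<alpha> z \<omega> = inverse (C_const chi) * L"
      by (intro exI[of _ "C_const chi * xray \<alpha> z \<omega>"]) simp
  qed
  show "\<forall>\<beta> :: real ^ 'n \<Rightarrow> real.
      C0_infinity \<beta> \<longrightarrow> (\<forall>x. \<beta> x \<ge> 0) \<longrightarrow> supp \<beta> \<subseteq> ball 0 R \<longrightarrow>
      (\<forall>(z, \<omega>) \<in> rays. Lim (at_right 0) (\<lambda>h. Data \<beta> chi \<delta> T h z \<omega>)
                       = Lim (at_right 0) (\<lambda>h. Data \<alpha> chi \<delta> T h z \<omega>)) \<longrightarrow>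
      \<beta> = \<alpha>"
  proof (intro allI impI)
    fix \<beta> :: "real ^ 'n \<Rightarrow> real"
    assume \<beta>: "C0_infinity \<beta>" "\<forall>x. \<beta> x \<ge> 0" "supp \<beta> \<subseteq> ball 0 R"
      and eq: "\<forall>(z, \<omega>) \<in> rays. Lim (at_right 0) (\<lambda>h. Data \<beta> chi \<delta> T h z \<omega>)
                              = Lim (at_right 0) (\<lambda>h. Data \<alpha> chi \<delta> T h z \<omega>)"
    have Lim: "Lim (at_right 0) (\<lambda>h. Data f chi \<delta> T h z \<omega>) = C_const chi * xray f z \<omega>"
      if "\<And>x. f x \<ge> 0" "supp f \<subseteq> ball 0 R" "(z, \<omega>) \<in> rays" for f :: "real ^ 'n \<Rightarrow> real" and z \<omega>
      by (rule tendsto_Lim[OF _ lim[OF that]]) simp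
    show "\<beta> = \<alpha>"
    proof (rule xray_injective[OF assms(1,2,4) \<beta>(1,3)])
      fix z \<omega> :: "real ^ 'n" assume ray: "(z, \<omega>) \<in> rays"
      with eq have "Lim (at_right 0) (\<lambda>h. Data \<beta> chi \<delta> T h z \<omega>)
                  = Lim (at_right 0) (\<lambda>h. Data \<alpha> chi \<delta> T h z \<omega>)" by auto
      then have "C_const chi * xray \<beta> z \<omega> = C_const chi * xray \<alpha> z \<omega>"
        using Lim[OF _ \<beta>(3) ray] Lim[OF assms(3,4) ray] \<beta>(2) by simp
      with pos show "xray \<beta> z \<omega> = xray \<alpha> z \<omega>" by simp
    qed
  qed
qed

end
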